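(* For a group $G$, the following conditions are equivalent: (i) $G$ is locally finite; (ii) for every set $A$, every cellular automaton $\tau\colon A^G\to A^G$ has closed image in the prodiscrete topology; (iii) for every infinite set $A$, every cellular automaton $\tau\colon A^G\to A^G$ has closed image in the prodiscrete topology; (iv) for some infinite set $A$, every cellular automaton $\tau\colon A^G\to A^G$ has closed image in the prodiscrete topology; (v) for every field $K$, every $K$-vector space $V$, and every linear cellular automaton $\tau\colon V^G\to V^G$, the image $\tau(V^G)$ is closed in the prodiscrete topology; (vi) for some field $K$ and some infinite-dimensional $K$-vector space $V$, every linear cellular automaton $\tau\colon V^G\to V^G$ has closed image in the prodiscrete topology.
   Context: We work in ZFC. A group is locally finite if every finitely generated subgroup of it is finite. For a group $G$ and a set $A$, $A^G$ is the set of all maps $G\to A$, with the prodiscrete topology: the product topology obtained by giving each factor $A$ the discrete topology. The group $G$ acts on $A^G$ by $(gx)(h)=x(g^{-1}h)$. A map $\tau\colon A^G\to A^G$ is a cellular automaton if there exist a finite subset $M\subset G$ (a memory set) and a map $\mu\colon A^M\to A$ (local defining map) such that $\tau(x)(g)=\mu((g^{-1}x)|_M)$ for all $x\in A^G$, $g\in G$; note $(g^{-1}x)(m)=x(gm)$. If $A=V$ is a vector space over a field $K$ and $\mu\colon V^M\to V$ can be taken $K$-linear, then $\tau$ is called a linear cellular automaton. *)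

theory Defs
  imports "HOL-Analysis.Function_Topology" "HOL-Algebra.Generated_Groups"
    "Jordan_Normal_Form.Missing_VectorSpace"
begin

text \<open>
  The locales \<^locale>\<open>vectorspace\<close> and \<^locale>\<open>module\<close>, the predicate \<open>vectorspace.fin_dim\<close>
  (existence of a finite generating set) and the set \<^const>\<open>module_hom\<close> of linear maps come from
  the AFP entry VectorSpace.
\<close>

definition locally_finite_group :: "('g, 'm) monoid_scheme \<Rightarrow> bool" where
  "locally_finite_group G \<longleftrightarrow>
     (\<forall>H. subgroup H G \<and> (\<exists>S. finite S \<and> S \<subseteq> carrier G \<and> H = generate G S) \<longrightarrow> finite H)"

text \<open>
  Maps \<open>G \<rightarrow> A\<close> are represented by extensional functions, i.e. functions that take the value
  \<^const>\<open>undefined\<close> outside the carrier of \<open>G\<close>; this makes equality of configurations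
  agree with equality of maps.
\<close>

definition configurations :: "('g, 'm) monoid_scheme \<Rightarrow> 'a set \<Rightarrow> ('g \<Rightarrow> 'a) set" where
  "configurations G A = (carrier G \<rightarrow>\<^sub>E A)"

definition prodiscrete :: "('g, 'm) monoid_scheme \<Rightarrow> 'a set \<Rightarrow> ('g \<Rightarrow> 'a) topology" where
  "prodiscrete G A = product_topology (\<lambda>_. discrete_topology A) (carrier G)"

definition shift :: "('g, 'm) monoid_scheme \<Rightarrow> 'g \<Rightarrow> ('g \<Rightarrow> 'a) \<Rightarrow> ('g \<Rightarrow> 'a)" where
  "shift G g x = (\<lambda>h\<in>carrier G. x (inv\<^bsub>G\<^esub> g \<otimes>\<^bsub>G\<^esub> h))"

text \<open>
  The values of \<open>\<tau>\<close> outside \<^term>\<open>configurations G A\<close> are unconstrained and play no role.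
\<close>

definition memory_rule ::
  "('g, 'm) monoid_scheme \<Rightarrow> 'a set \<Rightarrow> (('g \<Rightarrow> 'a) \<Rightarrow> ('g \<Rightarrow> 'a)) \<Rightarrow> 'g set \<Rightarrow> (('g \<Rightarrow> 'a) \<Rightarrow> 'a) \<Rightarrow> bool"
where
  "memory_rule G A \<tau> M \<mu> \<longleftrightarrow>
     finite M \<and> M \<subseteq> carrier G \<and> \<mu> \<in> (M \<rightarrow>\<^sub>E A) \<rightarrow> A \<and>
     (\<forall>x\<in>configurations G A. \<forall>g\<in>carrier G. \<tau> x g = \<mu> (restrict (shift G (inv\<^bsub>G\<^esub> g) x) M))"

definition cellular_automaton ::
  "('g, 'm) monoid_scheme \<Rightarrow> 'a set \<Rightarrow> (('g \<Rightarrow> 'a) \<Rightarrow> ('g \<Rightarrow> 'a)) \<Rightarrow> bool" where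
  "cellular_automaton G A \<tau> \<longleftrightarrow>
     \<tau> \<in> configurations G A \<rightarrow> configurations G A \<and> (\<exists>M \<mu>. memory_rule G A \<tau> M \<mu>)"

text \<open>
  The vector space \<open>V\<^sup>M\<close> with pointwise operations. A module record extends a ring record; its
  fields \<^const>\<open>mult\<close> and \<^const>\<open>one\<close> carry no meaning for modules and are filled arbitrarily.
\<close>

definition power_space :: "('k, 'v) module \<Rightarrow> 'g set \<Rightarrow> ('k, 'g \<Rightarrow> 'v) module" where
  "power_space V M =
     \<lparr>carrier = M \<rightarrow>\<^sub>E carrier V,
      mult = (\<lambda>x y. \<lambda>m\<in>M. \<zero>\<^bsub>V\<^esub>),
      one = (\<lambda>m\<in>M. \<zero>\<^bsub>V\<^esub>),
      zero = (\<lambda>m\<in>M. \<zero>\<^bsub>V\<^esub>),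
      add = (\<lambda>x y. \<lambda>m\<in>M. x m \<oplus>\<^bsub>V\<^esub> y m),
      smult = (\<lambda>c x. \<lambda>m\<in>M. c \<odot>\<^bsub>V\<^esub> x m)\<rparr>"

definition linear_cellular_automaton ::
  "('g, 'm) monoid_scheme \<Rightarrow> 'k ring \<Rightarrow> ('k, 'v) module \<Rightarrow> (('g \<Rightarrow> 'v) \<Rightarrow> ('g \<Rightarrow> 'v)) \<Rightarrow> bool" where
  "linear_cellular_automaton G K V \<tau> \<longleftrightarrow>
     \<tau> \<in> configurations G (carrier V) \<rightarrow> configurations G (carrier V) \<and>
     (\<exists>M \<mu>. memory_rule G (carrier V) \<tau> M \<mu> \<and> \<mu> \<in> module_hom K (power_space V M) V)"

definition has_closed_image ::
  "('g, 'm) monoid_scheme \<Rightarrow> 'a set \<Rightarrow> (('g \<Rightarrow> 'a) \<Rightarrow> ('g \<Rightarrow> 'a)) \<Rightarrow> bool" where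
  "has_closed_image G A \<tau> \<longleftrightarrow> closedin (prodiscrete G A) (\<tau> ` configurations G A)"

text \<open>
  HOL cannot quantify over types inside a formula, so a quantifier over all sets (fields, vector
  spaces) ranges over the subsets of (structures carried by subsets of) some type. In the main
  theorem each of the conditions on sets or spaces has its own independent type variables serving as
  universe. Since the theorem is universally quantified over these types, it says that local
  finiteness gives the universal conditions in every universe, and that an existential condition
  holding in any one universe already gives local finiteness. The universe must be large enough
  to contain an infinite set, resp. a field and an infinite-dimensional vector space: hence the
  assumptions that alphabet and vector types are infinite and scalar types have two elements.
  This loses no alphabets, since every set embeds into an infinite type.
\<close>

end

theory Submission
  imports Defs
begin

text \<open>
  If \<open>G\<close> is locally finite, a memory set generates a finite subgroup \<open>H\<close>, and the automaton acts
  independently on the finitely many coordinates of each coset \<open>gH\<close>; so preimages that match a given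
  configuration on every single coset can be glued.

  Otherwise some finite set \<open>S\<close> has the property that from every \<open>g\<close> one can leave any finite
  \<open>F \<subseteq> G\<close> by multiplying with letters of \<open>S\<close> on the right. For an infinite alphabet one
  takes a surjective rank onto the natural numbers and lets the automaton test whether some
  neighbour \<open>gs\<close> has smaller rank than \<open>g\<close>: this can be achieved everywhere on a finite set, but
  not everywhere on \<open>G\<close>.

  In the linear case one uses a sequence \<open>s\<^sub>0, s\<^sub>1, \<dots>\<close> in \<open>S\<close> that contains every word, and the
  conditions \<open>x\<^sub>0(g) = 1\<close> and \<open>x\<^sub>n\<^sub>+\<^sub>1(g) = x\<^sub>n(g s\<^sub>n)\<close> on the coordinates \<open>x\<^sub>n(g)\<close> along an infinite
  independent family. Imposed on all of \<open>G\<close>, they force \<open>x\<^sub>n(g) = 1\<close> for all \<open>n\<close>, which no vector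
  satisfies. Imposed on a finite \<open>F\<close> only, with \<open>x = 0\<close> outside, \<open>x\<^sub>n(g)\<close> is the indicator of the path
  \<open>g, g s\<^sub>n\<^sub>-\<^sub>1, g s\<^sub>n\<^sub>-\<^sub>1 s\<^sub>n\<^sub>-\<^sub>2, \<dots>\<close> staying in \<open>F\<close>. This vanishes for large \<open>n\<close>, since a single word
  moves all points of \<open>F\<close> out of \<open>F\<close> at some stage.
\<close>

section \<open>Local rules and closed sets of configurations\<close>

text \<open>The automaton with local rule \<mu>, free of shifts and inverses. The restriction to the
  carrier makes the values extensional, so that they are configurations.\<close>

definition local_map ::
  "('g, 'm) monoid_scheme \<Rightarrow> 'g set \<Rightarrow> (('g \<Rightarrow> 'a) \<Rightarrow> 'a) \<Rightarrow> ('g \<Rightarrow> 'a) \<Rightarrow> ('g \<Rightarrow> 'a)" where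
  "local_map G M \<mu> x = (\<lambda>g\<in>carrier G. \<mu> (\<lambda>m\<in>M. x (g \<otimes>\<^bsub>G\<^esub> m)))"

text \<open>A basic open set constrains finitely many coordinates, and since the factors are
  discrete it can be shrunk to fix these coordinates exactly. All later arguments see the topology
  only through this criterion.\<close>

lemma closedin_prodiscrete_iff:
  "closedin (prodiscrete G A) C \<longleftrightarrow>
     C \<subseteq> configurations G A \<and>
     (\<forall>y\<in>configurations G A.
        (\<forall>F. finite F \<and> F \<subseteq> carrier G \<longrightarrow> (\<exists>x\<in>C. \<forall>g\<in>F. x g = y g)) \<longrightarrow> y \<in> C)"
proof -
  let ?X = "\<lambda>_. discrete_topology A" and ?I = "carrier G"
  have top: "topspace (prodiscrete G A) = configurations G A"
    by (simp add: prodiscrete_def configurations_def)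
  have "openin (prodiscrete G A) (configurations G A - C) \<longleftrightarrow>
      (\<forall>y\<in>configurations G A - C. \<exists>F. finite F \<and> F \<subseteq> ?I \<and> (\<forall>x\<in>C. \<exists>g\<in>F. x g \<noteq> y g))"
    if C: "C \<subseteq> configurations G A"
  proof (intro iffI ballI)
    fix y
    assume op: "openin (prodiscrete G A) (configurations G A - C)"
      and y: "y \<in> configurations G A - C"
    obtain U where U: "finite {i \<in> ?I. U i \<noteq> A}" "y \<in> Pi\<^sub>E ?I U"
        "Pi\<^sub>E ?I U \<subseteq> configurations G A - C" "\<forall>i\<in>?I. U i \<subseteq> A"
      using op y unfolding prodiscrete_def openin_product_topology_alt
      by simp (drule bspec[of _ _ y], auto)
    \<comment> \<open>The finitely many coordinates that the box \<open>U\<close> really constrains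
      serve as \<open>F\<close>: an element of \<open>C\<close> agreeing with \<open>y\<close> on
      them would lie in the box.\<close>
    have "\<exists>g\<in>{i \<in> ?I. U i \<noteq> A}. x g \<noteq> y g" if x: "x \<in> C" for x
    proof (rule ccontr)
      assume "\<not> ?thesis"
      then have eq: "\<And>g. g \<in> ?I \<Longrightarrow> U g \<noteq> A \<Longrightarrow> x g = y g" by blast
      have "x \<in> ?I \<rightarrow>\<^sub>E A" using x C by (auto simp: configurations_def)
      then have "x \<in> Pi\<^sub>E ?I U"
        using PiE_mem[OF U(2)] eq unfolding PiE_iff by metis
      then show False using U(3) x by blast
    qed
    then show "\<exists>F. finite F \<and> F \<subseteq> ?I \<and> (\<forall>x\<in>C. \<exists>g\<in>F. x g \<noteq> y g)"
      using U(1) by (intro exI[of _ "{i \<in> ?I. U i \<noteq> A}"]) blast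
  next
    assume R: "\<forall>y\<in>configurations G A - C.
        \<exists>F. finite F \<and> F \<subseteq> ?I \<and> (\<forall>x\<in>C. \<exists>g\<in>F. x g \<noteq> y g)"
    show "openin (prodiscrete G A) (configurations G A - C)"
      unfolding prodiscrete_def openin_product_topology_alt
    proof
      fix y assume y: "y \<in> configurations G A - C"
      then obtain F where F: "finite F" "F \<subseteq> ?I" "\<forall>x\<in>C. \<exists>g\<in>F. x g \<noteq> y g"
        using bspec[OF R y] by blast
      \<comment> \<open>The cylinder of \<open>y\<close> over \<open>F\<close>: singletons on
        \<open>F\<close> and no condition elsewhere.\<close>
      define U where "U = (\<lambda>g. if g \<in> F then {y g} else A)"
      have "y \<in> ?I \<rightarrow>\<^sub>E A" using y by (simp add: configurations_def)
      then have yA: "\<And>g. g \<in> ?I \<Longrightarrow> y g \<in> A" "y \<in> extensional ?I" by (auto simp: PiE_iff)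
      have "finite {i \<in> ?I. U i \<noteq> topspace (discrete_topology A)}"
        using F(1) by (rule rev_finite_subset) (auto simp: U_def split: if_splits)
      moreover have "\<forall>i\<in>?I. openin (discrete_topology A) (U i)"
        using yA by (auto simp: U_def)
      moreover have "y \<in> Pi\<^sub>E ?I U"
        using yA by (auto simp: U_def PiE_iff)
      moreover have "Pi\<^sub>E ?I U \<subseteq> configurations G A - C"
      proof
        fix x assume x: "x \<in> Pi\<^sub>E ?I U"
        have "U i \<subseteq> A" if "i \<in> ?I" for i using yA that by (auto simp: U_def)
        then have "x \<in> configurations G A"
          using x unfolding configurations_def PiE_iff by blast
        moreover have "\<forall>g\<in>F. x g = y g"
          using x F(2) unfolding PiE_iff U_def by (metis singletonD subsetD)
        ultimately show "x \<in> configurations G A - C" using F(3) by blast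
      qed
      ultimately show "\<exists>U. finite {i \<in> ?I. U i \<noteq> topspace (discrete_topology A)} \<and>
          (\<forall>i\<in>?I. openin (discrete_topology A) (U i)) \<and> y \<in> Pi\<^sub>E ?I U \<and>
          Pi\<^sub>E ?I U \<subseteq> configurations G A - C" by blast
    qed
  qed
  \<comment> \<open>\<open>P y\<close> says that \<open>y\<close> is a limit of \<open>C\<close>.
    With a name for it the rest is propositional reasoning about complements.\<close>
  moreover define P where
    "P y \<longleftrightarrow> (\<forall>F. finite F \<and> F \<subseteq> ?I \<longrightarrow> (\<exists>x\<in>C. \<forall>g\<in>F. x g = y g))" for y
  moreover have "(\<exists>F. finite F \<and> F \<subseteq> ?I \<and> (\<forall>x\<in>C. \<exists>g\<in>F. x g \<noteq> y g)) \<longleftrightarrow> \<not> P y" for y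
    unfolding P_def by metis
  ultimately have "openin (prodiscrete G A) (configurations G A - C) \<longleftrightarrow>
      (\<forall>y\<in>configurations G A - C. \<not> P y)"
    if "C \<subseteq> configurations G A"
    using that by presburger
  then have "C \<subseteq> configurations G A \<and> openin (prodiscrete G A) (configurations G A - C) \<longleftrightarrow>
      C \<subseteq> configurations G A \<and> (\<forall>y\<in>configurations G A. P y \<longrightarrow> y \<in> C)"
    by auto
  then show ?thesis
    by (simp only: closedin_def top P_def)
qed

text \<open>Both counterexamples are presented in this form: a limit of images that has no preimage
  itself.\<close>

lemma not_has_closed_imageI:
  assumes "y \<in> configurations G A"
    and "\<And>F. finite F \<Longrightarrow> F \<subseteq> carrier G \<Longrightarrow> \<exists>x\<in>configurations G A. \<forall>g\<in>F. \<tau> x g = y g"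
    and "\<And>x. x \<in> configurations G A \<Longrightarrow> \<tau> x \<noteq> y"
  shows "\<not> has_closed_image G A \<tau>"
proof
  assume "has_closed_image G A \<tau>"
  then have "y \<in> \<tau> ` configurations G A"
    using assms(1,2) unfolding has_closed_image_def closedin_prodiscrete_iff
    by (metis image_eqI)
  then show False using assms(3) by blast
qed

section \<open>Cellular automata on a group and the locally finite case\<close>

context group
begin

lemma restrict_shift_inv:
  assumes "g \<in> carrier G" "M \<subseteq> carrier G"
  shows "restrict (shift G (inv g) x) M = (\<lambda>m\<in>M. x (g \<otimes> m))"
  using assms by (intro restrict_ext) (auto simp: shift_def)

lemma configurations_translate:
  assumes "x \<in> configurations G A" "g \<in> carrier G" "M \<subseteq> carrier G"
  shows "(\<lambda>m\<in>M. x (g \<otimes> m)) \<in> M \<rightarrow>\<^sub>E A"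
  using assms by (auto simp: configurations_def PiE_iff)

lemma local_map_closed:
  assumes "M \<subseteq> carrier G" "\<mu> \<in> (M \<rightarrow>\<^sub>E A) \<rightarrow> A"
  shows "local_map G M \<mu> \<in> configurations G A \<rightarrow> configurations G A"
proof
  fix x assume x: "x \<in> configurations G A"
  have "\<mu> (\<lambda>m\<in>M. x (g \<otimes> m)) \<in> A" if "g \<in> carrier G" for g
    using configurations_translate[OF x that assms(1)] assms(2) by blast
  then show "local_map G M \<mu> x \<in> configurations G A"
    by (simp add: configurations_def local_map_def)
qed

lemma memory_rule_local_map:
  assumes "finite M" "M \<subseteq> carrier G" "\<mu> \<in> (M \<rightarrow>\<^sub>E A) \<rightarrow> A"
  shows "memory_rule G A (local_map G M \<mu>) M \<mu>"
  using assms by (auto simp: memory_rule_def local_map_def restrict_shift_inv)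

lemma cellular_automaton_local_map:
  assumes "finite M" "M \<subseteq> carrier G" "\<mu> \<in> (M \<rightarrow>\<^sub>E A) \<rightarrow> A"
  shows "cellular_automaton G A (local_map G M \<mu>)"
  using memory_rule_local_map[OF assms] local_map_closed[OF assms(2,3)]
  unfolding cellular_automaton_def by blast

text \<open>On group elements this is the memory rule; outside the carrier both sides are
  \<open>undefined\<close>, because \<open>\<tau> x\<close> is a configuration.\<close>

lemma cellular_automatonE:
  assumes "cellular_automaton G A \<tau>"
  obtains M \<mu> where "finite M" "M \<subseteq> carrier G" "\<mu> \<in> (M \<rightarrow>\<^sub>E A) \<rightarrow> A"
    "\<And>x. x \<in> configurations G A \<Longrightarrow> \<tau> x = local_map G M \<mu> x"
proof -
  obtain M \<mu> where \<tau>: "\<tau> \<in> configurations G A \<rightarrow> configurations G A"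
    and mr: "memory_rule G A \<tau> M \<mu>"
    using assms unfolding cellular_automaton_def by blast
  from mr have *: "finite M" "M \<subseteq> carrier G" "\<mu> \<in> (M \<rightarrow>\<^sub>E A) \<rightarrow> A"
    by (auto simp: memory_rule_def)
  have "\<tau> x = local_map G M \<mu> x" if x: "x \<in> configurations G A" for x
  proof
    fix g
    show "\<tau> x g = local_map G M \<mu> x g"
    proof (cases "g \<in> carrier G")
      case True
      then show ?thesis
        using mr x * by (simp add: memory_rule_def local_map_def restrict_shift_inv)
    next
      case False
      have "\<tau> x \<in> configurations G A" using \<tau> x by blast
      with False show ?thesis
        by (simp add: local_map_def configurations_def PiE_arb[of "\<tau> x"])
    qed
  qed
  with * that show thesis by blast
qed

lemma has_closed_image_if_locally_finite:
  assumes lf: "locally_finite_group G" and ca: "cellular_automaton G A \<tau>"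
  shows "has_closed_image G A \<tau>"
proof -
  from ca obtain M \<mu> where M: "finite M" "M \<subseteq> carrier G" "\<mu> \<in> (M \<rightarrow>\<^sub>E A) \<rightarrow> A"
    and \<tau>: "\<And>x. x \<in> configurations G A \<Longrightarrow> \<tau> x = local_map G M \<mu> x"
    by (rule cellular_automatonE) blast
  define H where "H = generate G M"
  have H: "subgroup H G" unfolding H_def by (rule generate_is_subgroup[OF M(2)])
  then have finH: "finite H"
    using lf M unfolding locally_finite_group_def H_def by blast
  have Hsub: "H \<subseteq> carrier G" using H by (rule subgroup.subset)
  have MH: "M \<subseteq> H" unfolding H_def by (auto intro: generate.incl)
  have "y \<in> \<tau> ` configurations G A"
    if y: "y \<in> configurations G A"
      and approx: "\<And>F. finite F \<Longrightarrow> F \<subseteq> carrier G \<Longrightarrow>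
        \<exists>x\<in>\<tau> ` configurations G A. \<forall>g\<in>F. x g = y g" for y
  proof -
    \<comment> \<open>Finiteness of \<open>H\<close> lets every whole coset be used as a finite set
      in \<open>approx\<close>.\<close>
    have fin: "finite (g <# H)" "g <# H \<subseteq> carrier G" if "g \<in> carrier G" for g
      using that finH Hsub by (auto simp: l_coset_def)
    have "\<exists>x\<in>configurations G A. \<forall>h\<in>g <# H. \<tau> x h = y h" if "g \<in> carrier G" for g
      using approx[OF fin[OF that]] by blast
    \<comment> \<open>The choice is indexed by the coset as a set, not by a representative, so that
      all elements of a coset read from the same preimage.\<close>
    then have "\<forall>Q\<in>(\<lambda>g. g <# H) ` carrier G.
        \<exists>x. x \<in> configurations G A \<and> (\<forall>h\<in>Q. \<tau> x h = y h)"
      by blast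
    then obtain X where X:
      "\<forall>Q\<in>(\<lambda>g. g <# H) ` carrier G. X Q \<in> configurations G A \<and> (\<forall>h\<in>Q. \<tau> (X Q) h = y h)"
      by metis
    define x where "x = (\<lambda>g\<in>carrier G. X (g <# H) g)"
    have x: "x \<in> configurations G A"
      using X by (fastforce simp: x_def configurations_def)
    have "\<tau> x = y"
    proof
      fix g
      show "\<tau> x g = y g"
      proof (cases "g \<in> carrier G")
        case True
        \<comment> \<open>The window at \<open>g\<close> lies inside the coset of \<open>g\<close>,
          where the glued configuration is the one chosen for that coset.\<close>
        have "x (g \<otimes> m) = X (g <# H) (g \<otimes> m)" if "m \<in> M" for m
        proof -
          have "g \<otimes> m \<in> g <# H" using that MH by (auto simp: l_coset_def)
          then have "(g \<otimes> m) <# H = g <# H"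
            using l_repr_independence[OF _ True H] by simp
          then show ?thesis using True that M(2) by (auto simp: x_def)
        qed
        then have "(\<lambda>m\<in>M. x (g \<otimes> m)) = (\<lambda>m\<in>M. X (g <# H) (g \<otimes> m))"
          by (auto simp: restrict_def)
        moreover have "g \<in> g <# H"
          using True subgroup.one_closed[OF H] by (force simp: l_coset_def)
        then have "\<tau> (X (g <# H)) g = y g" "X (g <# H) \<in> configurations G A"
          using X True by auto
        ultimately show ?thesis
          using \<tau>[OF x] \<tau> True by (simp add: local_map_def)
      next
        case False
        then show ?thesis
          using y \<tau>[OF x] by (simp add: local_map_def configurations_def PiE_arb[of y])
      qed
    qed
    then show ?thesis using x by blast
  qed
  moreover have "\<tau> ` configurations G A \<subseteq> configurations G A"
    using ca by (auto simp: cellular_automaton_def)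
  ultimately show ?thesis
    unfolding has_closed_image_def closedin_prodiscrete_iff by simp
qed

section \<open>Words, and groups that are not locally finite\<close>

text \<open>Here and below, \<open>foldl (\<otimes>) g u\<close> is the end point of the walk that
  starts at \<open>g\<close> and multiplies by the letters of \<open>u\<close> on the right.\<close>

lemma foldl_mult_closed:
  "g \<in> carrier G \<Longrightarrow> u \<in> lists (carrier G) \<Longrightarrow> foldl (\<otimes>) g u \<in> carrier G"
  by (induction u arbitrary: g) auto

lemma foldl_mult_eq:
  "g \<in> carrier G \<Longrightarrow> h \<in> carrier G \<Longrightarrow> u \<in> lists (carrier G) \<Longrightarrow>
     foldl (\<otimes>) (g \<otimes> h) u = g \<otimes> foldl (\<otimes>) h u"
  by (induction u arbitrary: h) (auto simp: m_assoc)

lemma generate_imp_word: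
  assumes "S \<subseteq> carrier G" "h \<in> generate G S"
  shows "\<exists>u\<in>lists (S \<union> m_inv G ` S). h = foldl (\<otimes>) \<one> u"
  using assms(2)
proof induction
  case one
  show ?case by (intro bexI[of _ "[]"]) auto
next
  case (incl h)
  then show ?case using assms(1) by (intro bexI[of _ "[h]"]) auto
next
  case (inv h)
  then show ?case using assms(1) by (intro bexI[of _ "[inv h]"]) auto
next
  case (eng h1 h2)
  then obtain u v where uv: "u \<in> lists (S \<union> m_inv G ` S)" "h1 = foldl (\<otimes>) \<one> u"
    "v \<in> lists (S \<union> m_inv G ` S)" "h2 = foldl (\<otimes>) \<one> v" by blast
  have sub: "lists (S \<union> m_inv G ` S) \<subseteq> lists (carrier G)"
    using assms(1) by (intro lists_mono) auto
  have h1: "h1 \<in> carrier G" using eng.hyps generate_in_carrier[OF assms(1)] by blast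
  have "foldl (\<otimes>) \<one> (u @ v) = h1 \<otimes> h2"
    using foldl_mult_eq[OF h1 one_closed, of v] uv sub h1 by auto
  with uv show ?case by (intro bexI[of _ "u @ v"]) auto
qed

text \<open>An infinite finitely generated subgroup has infinitely many end points of words over its
  generators and their inverses. If all walks from \<open>g\<close> ended in \<open>F\<close>, a
  left translate of the finite set \<open>F\<close> would contain all of these end points.\<close>

lemma not_locally_finiteE:
  assumes "\<not> locally_finite_group G"
  obtains S where "finite S" "S \<subseteq> carrier G" "S \<noteq> {}"
    "\<And>F g. finite F \<Longrightarrow> g \<in> carrier G \<Longrightarrow> \<exists>u\<in>lists S. foldl (\<otimes>) g u \<notin> F"
proof -
  from assms obtain S where S: "finite S" "S \<subseteq> carrier G" "infinite (generate G S)"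
    unfolding locally_finite_group_def by blast
  define T where "T = S \<union> m_inv G ` S"
  have T: "finite T" "T \<subseteq> carrier G" using S by (auto simp: T_def)
  have "generate G S \<subseteq> foldl (\<otimes>) \<one> ` lists T"
    using generate_imp_word[OF S(2)] unfolding T_def by blast
  with S(3) have inf: "infinite (foldl (\<otimes>) \<one> ` lists T)"
    using finite_subset by blast
  \<comment> \<open>Over the empty alphabet there is only one word, hence one end point.
    Nonemptiness is needed later to choose a sequence of letters.\<close>
  then have "T \<noteq> {}" by auto
  moreover have "\<exists>u\<in>lists T. foldl (\<otimes>) g u \<notin> F" if F: "finite F" and g: "g \<in> carrier G" for F g
  proof (rule ccontr)
    have sub: "lists T \<subseteq> lists (carrier G)" using T(2) by (rule lists_mono)
    assume "\<not> ?thesis"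
    then have "\<forall>u\<in>lists T. foldl (\<otimes>) \<one> u \<in> (\<lambda>h. inv g \<otimes> h) ` F"
    proof (intro ballI)
      fix u assume *: "\<not> (\<exists>u\<in>lists T. foldl (\<otimes>) g u \<notin> F)" and u: "u \<in> lists T"
      have "foldl (\<otimes>) \<one> u = inv g \<otimes> foldl (\<otimes>) g u"
        using foldl_mult_eq[of "inv g" g u] g u sub by auto
      with * u show "foldl (\<otimes>) \<one> u \<in> (\<lambda>h. inv g \<otimes> h) ` F" by blast
    qed
    then have "foldl (\<otimes>) \<one> ` lists T \<subseteq> (\<lambda>h. inv g \<otimes> h) ` F" by blast
    with F inf show False by (meson finite_imageI finite_subset)
  qed
  ultimately show thesis using that T by blast
qed

lemma exists_automaton_not_closed:
  assumes nlf: "\<not> locally_finite_group G" and A: "infinite A"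
  shows "\<exists>\<tau>. cellular_automaton G A \<tau> \<and> \<not> has_closed_image G A \<tau>"
proof -
  from nlf obtain S where S: "finite S" "S \<subseteq> carrier G"
    and exit: "\<And>F g. finite F \<Longrightarrow> g \<in> carrier G \<Longrightarrow> \<exists>u\<in>lists S. foldl (\<otimes>) g u \<notin> F"
    by (metis not_locally_finiteE)
  from A obtain f :: "nat \<Rightarrow> 'c" where f: "inj f" "range f \<subseteq> A"
    using infinite_countable_subset by blast
  \<comment> \<open>The rank is a left inverse of \<open>f\<close>. Off the range of
    \<open>f\<close> its value is an unspecified natural number, which is harmless: only
    \<open>r (f n) = n\<close> and the well-ordering of ranks matter.\<close>
  define r where "r = inv_into UNIV f"
  have r: "r (f n) = n" for n using f(1) by (simp add: r_def)
  \<comment> \<open>The neutral element belongs to the memory because a cell compares its own rank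
    with those of its neighbours.\<close>
  define M where "M = insert \<one> S"
  have M: "finite M" "M \<subseteq> carrier G" using S by (auto simp: M_def)
  \<comment> \<open>A preimage of the constant \<open>f 0\<close> would give an infinite descent of ranks, whereas the
    distance to the complement of a finite set descends towards that complement.\<close>
  define \<mu> where "\<mu> z = (if \<exists>s\<in>S. r (z s) < r (z \<one>) then f 0 else f 1)" for z :: "'a \<Rightarrow> 'c"
  have \<mu>: "\<mu> \<in> (M \<rightarrow>\<^sub>E A) \<rightarrow> A" using f(2) by (auto simp: \<mu>_def)
  have \<tau>: "local_map G M \<mu> x g = (if \<exists>s\<in>S. r (x (g \<otimes> s)) < r (x g) then f 0 else f 1)"
    if "g \<in> carrier G" for x g
    using that by (simp add: local_map_def \<mu>_def M_def)
  define y where "y = (\<lambda>g\<in>carrier G. f 0)"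
  have "\<not> has_closed_image G A (local_map G M \<mu>)"
  proof (rule not_has_closed_imageI)
    show "y \<in> configurations G A" using f(2) by (auto simp: y_def configurations_def)
  next
    fix F assume F: "finite F" "F \<subseteq> carrier G"
    define P where "P g n \<longleftrightarrow> (\<exists>u\<in>lists S. length u = n \<and> foldl (\<otimes>) g u \<notin> F)" for g n
    \<comment> \<open>The length of a shortest word leading from \<open>g\<close> out of
      \<open>F\<close>. It exists by \<open>exit\<close>, and for a group element it is zero exactly
      outside \<open>F\<close>.\<close>
    define d where "d g = (LEAST n. P g n)" for g
    define x where "x = (\<lambda>g\<in>carrier G. f (d g))"
    have "local_map G M \<mu> x g = y g" if g: "g \<in> F" for g
    proof -
      have gc: "g \<in> carrier G" using g F by blast
      have "\<exists>n. P g n" using exit[OF F(1) gc] unfolding P_def by blast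
      then have "P g (d g)" unfolding d_def by (rule LeastI_ex)
      then obtain u where u: "u \<in> lists S" "length u = d g" "foldl (\<otimes>) g u \<notin> F"
        unfolding P_def by blast
      \<comment> \<open>Since \<open>g\<close> is in \<open>F\<close>, the empty word does not lead
        out. The first letter of a shortest word then points to a neighbour at smaller
        distance.\<close>
      then obtain s v where sv: "u = s # v" using g by (cases u) auto
      have "P (g \<otimes> s) (length v)" using u sv unfolding P_def by auto
      then have "d (g \<otimes> s) \<le> length v" unfolding d_def by (rule Least_le)
      then have "d (g \<otimes> s) < d g" using u sv by simp
      moreover have "s \<in> S" "g \<otimes> s \<in> carrier G" using u sv S gc by auto
      ultimately show ?thesis using gc by (auto simp: \<tau> y_def x_def r)
    qed
    moreover have "x \<in> configurations G A"
      using f(2) by (auto simp: x_def configurations_def)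
    ultimately show "\<exists>x\<in>configurations G A. \<forall>g\<in>F. local_map G M \<mu> x g = y g" by blast
  next
    fix x
    show "local_map G M \<mu> x \<noteq> y"
    proof
      assume eq: "local_map G M \<mu> x = y"
      have desc: "\<exists>s\<in>S. r (x (g \<otimes> s)) < r (x g)" if "g \<in> carrier G" for g
        using fun_cong[OF eq, of g] that f(1) by (auto simp: \<tau> y_def inj_eq split: if_splits)
      \<comment> \<open>Ranks are natural numbers, so some cell has least rank, and
        \<open>desc\<close> fails there.\<close>
      obtain g where "g \<in> carrier G" "\<And>h. h \<in> carrier G \<Longrightarrow> r (x g) \<le> r (x h)"
        using ex_has_least_nat[of "\<lambda>g. g \<in> carrier G" \<one> "\<lambda>g. r (x g)"] by auto
      with desc S(2) show False by (meson leD m_closed subsetD)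
    qed
  qed
  then show ?thesis using cellular_automaton_local_map[OF M \<mu>] by blast
qed

end

section \<open>Coordinates in infinite-dimensional vector spaces\<close>

text \<open>The direct sum of countably many copies of \<open>K\<close>.\<close>

definition fin_seqs :: "('k, 'm) ring_scheme \<Rightarrow> (nat \<Rightarrow> 'k) set" where
  "fin_seqs K = {c. (\<forall>n. c n \<in> carrier K) \<and> finite {n. c n \<noteq> \<zero>\<^bsub>K\<^esub>}}"

context vectorspace
begin

text \<open>Zorn's lemma yields a basis. A linear dependence involves finitely many vectors, so in
  the union of a chain it already occurs in one member; and a vector outside the span could be added
  to a maximal family.\<close>

lemma ex_maximal_lin_indpt:
  obtains B where "B \<subseteq> carrier V" "lin_indpt B" "span B = carrier V"
proof -
  define \<S> where "\<S> = {B. B \<subseteq> carrier V \<and> lin_indpt B}"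
  have "\<Union>C \<in> \<S>" if C_chain: "C \<noteq> {}" "subset.chain \<S> C" for C
  proof -
    have C: "C \<subseteq> \<S>" using C_chain(2) by (simp add: subset.chain_def)
    have "lin_indpt (\<Union>C)"
    proof
      assume "lin_dep (\<Union>C)"
      then obtain A a v where A: "finite A" "A \<subseteq> \<Union>C" "a \<in> A \<rightarrow> carrier K"
        "lincomb a A = \<zero>\<^bsub>V\<^esub>" "v \<in> A" "a v \<noteq> \<zero>\<^bsub>K\<^esub>"
        unfolding lin_dep_def by blast
      obtain D where "D \<in> C" "A \<subseteq> D"
        using finite_subset_Union_chain[OF A(1,2) C_chain] by blast
      then have "lin_dep D" using A unfolding lin_dep_def by blast
      with \<open>D \<in> C\<close> C show False by (auto simp: \<S>_def)
    qed
    moreover have "\<Union>C \<subseteq> carrier V" using C by (auto simp: \<S>_def)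
    ultimately show ?thesis by (simp add: \<S>_def)
  qed
  moreover have "{} \<in> \<S>" by (simp add: \<S>_def lin_dep_def)
  ultimately obtain B where B: "B \<in> \<S>" and max: "\<And>X. X \<in> \<S> \<Longrightarrow> B \<subseteq> X \<Longrightarrow> X = B"
    using subset_Zorn_nonempty[of \<S>] by blast
  have BV: "B \<subseteq> carrier V" "lin_indpt B" using B by (auto simp: \<S>_def)
  have "v \<in> span B" if v: "v \<in> carrier V" for v
  proof (cases "v \<in> B")
    case True
    then show ?thesis using in_own_span[OF BV(1)] by blast
  next
    case False
    then have "lin_dep (B \<union> {v})" using max[of "B \<union> {v}"] BV v by (auto simp: \<S>_def)
    then show ?thesis using lin_dep_iff_in_span[OF BV v False] by blast
  qed
  moreover have "span B \<subseteq> carrier V" by (rule span_is_subset2[OF BV(1)])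
  ultimately show thesis using that BV by blast
qed

text \<open>The space is the direct sum of the line through \<open>b\<close> and \<open>W\<close>,
  and \<open>f\<close> reads off the coefficient of \<open>b\<close>.\<close>

lemma ex_functional:
  assumes W: "submodule K W V" and b: "b \<in> carrier V" "b \<notin> W"
    and dec: "\<And>v. v \<in> carrier V \<Longrightarrow> \<exists>c\<in>carrier K. \<exists>w\<in>W. v = c \<odot>\<^bsub>V\<^esub> b \<oplus>\<^bsub>V\<^esub> w"
  shows "\<exists>f. (\<forall>v\<in>carrier V. f v \<in> carrier K) \<and> f b = \<one>\<^bsub>K\<^esub> \<and> (\<forall>w\<in>W. f w = \<zero>\<^bsub>K\<^esub>) \<and>
    (\<forall>u\<in>carrier V. \<forall>v\<in>carrier V. f (u \<oplus>\<^bsub>V\<^esub> v) = f u \<oplus>\<^bsub>K\<^esub> f v) \<and>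
    (\<forall>c\<in>carrier K. \<forall>v\<in>carrier V. f (c \<odot>\<^bsub>V\<^esub> v) = c \<otimes>\<^bsub>K\<^esub> f v)"
proof -
  note WV = subsetD[OF submodule.subset[OF W]]
  have neg: "\<ominus>\<^bsub>V\<^esub> w \<in> W" if "w \<in> W" for w
    using submodule.smult_closed[OF W, of "\<ominus>\<^bsub>K\<^esub> \<one>\<^bsub>K\<^esub>" w] that WV by (simp add: smult_minus_1)
  \<comment> \<open>Distinct coefficients would put a nonzero multiple of \<open>b\<close> into
    \<open>W\<close>, and after division by the scalar \<open>b\<close> itself.\<close>
  have uniq: "c = d"
    if cd: "c \<in> carrier K" "d \<in> carrier K" "u \<in> W" "w \<in> W"
      and eq: "c \<odot>\<^bsub>V\<^esub> b \<oplus>\<^bsub>V\<^esub> u = d \<odot>\<^bsub>V\<^esub> b \<oplus>\<^bsub>V\<^esub> w" for c d u w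
  proof (rule ccontr)
    assume "c \<noteq> d"
    define e where "e = c \<ominus>\<^bsub>K\<^esub> d"
    have e: "e \<in> carrier K" "e \<noteq> \<zero>\<^bsub>K\<^esub>" using cd \<open>c \<noteq> d\<close> by (auto simp: e_def)
    have "e \<odot>\<^bsub>V\<^esub> b = c \<odot>\<^bsub>V\<^esub> b \<oplus>\<^bsub>V\<^esub> \<ominus>\<^bsub>V\<^esub> (d \<odot>\<^bsub>V\<^esub> b)"
      using cd b by (simp add: e_def R.minus_eq smult_l_distr smult_l_minus)
    also have "c \<odot>\<^bsub>V\<^esub> b = d \<odot>\<^bsub>V\<^esub> b \<oplus>\<^bsub>V\<^esub> w \<oplus>\<^bsub>V\<^esub> \<ominus>\<^bsub>V\<^esub> u"
      using eq cd b WV by (metis M.add.inv_solve_right' M.add.m_closed smult_closed)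
    also have "\<dots> \<oplus>\<^bsub>V\<^esub> \<ominus>\<^bsub>V\<^esub> (d \<odot>\<^bsub>V\<^esub> b) = w \<oplus>\<^bsub>V\<^esub> \<ominus>\<^bsub>V\<^esub> u"
      using cd b WV by (simp add: M.a_ac M.r_neg M.r_neg1 M.r_neg2)
    finally have "e \<odot>\<^bsub>V\<^esub> b \<in> W"
      using cd neg submodule.m_closed[OF W] by simp
    then have "inv\<^bsub>K\<^esub> e \<odot>\<^bsub>V\<^esub> (e \<odot>\<^bsub>V\<^esub> b) \<in> W"
      using submodule.smult_closed[OF W] e by blast
    moreover have "inv\<^bsub>K\<^esub> e \<odot>\<^bsub>V\<^esub> (e \<odot>\<^bsub>V\<^esub> b) = b"
      using mult_inverse[OF e(1) b(1) refl e(2)] by simp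
    ultimately show False using b by simp
  qed
  define f where "f v = (THE c. c \<in> carrier K \<and> (\<exists>w\<in>W. v = c \<odot>\<^bsub>V\<^esub> b \<oplus>\<^bsub>V\<^esub> w))" for v
  have fI: "f v = c" if "c \<in> carrier K" "w \<in> W" "v = c \<odot>\<^bsub>V\<^esub> b \<oplus>\<^bsub>V\<^esub> w" for v c w
    unfolding f_def by (rule the_equality) (use that uniq in blast)+
  show ?thesis
  proof (intro exI[of _ f] conjI ballI)
    fix v assume "v \<in> carrier V"
    then show "f v \<in> carrier K" using dec fI by metis
  next
    show "f b = \<one>\<^bsub>K\<^esub>"
      using b by (intro fI[of _ "\<zero>\<^bsub>V\<^esub>"]) (auto simp: submodule.zero_closed[OF W])
  next
    fix w assume w: "w \<in> W"
    then show "f w = \<zero>\<^bsub>K\<^esub>" using b WV by (intro fI[of _ w]) auto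
  next
    fix u v assume uv: "u \<in> carrier V" "v \<in> carrier V"
    obtain c w where c: "c \<in> carrier K" "w \<in> W" "u = c \<odot>\<^bsub>V\<^esub> b \<oplus>\<^bsub>V\<^esub> w" using dec uv by blast
    obtain d x where d: "d \<in> carrier K" "x \<in> W" "v = d \<odot>\<^bsub>V\<^esub> b \<oplus>\<^bsub>V\<^esub> x" using dec uv by blast
    have "u \<oplus>\<^bsub>V\<^esub> v = (c \<oplus>\<^bsub>K\<^esub> d) \<odot>\<^bsub>V\<^esub> b \<oplus>\<^bsub>V\<^esub> (w \<oplus>\<^bsub>V\<^esub> x)"
      using c d b WV by (simp add: smult_l_distr M.a_ac)
    then show "f (u \<oplus>\<^bsub>V\<^esub> v) = f u \<oplus>\<^bsub>K\<^esub> f v"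
      using fI[OF c] fI[OF d] fI[of "c \<oplus>\<^bsub>K\<^esub> d" "w \<oplus>\<^bsub>V\<^esub> x"] c d submodule.m_closed[OF W] by simp
  next
    fix a v assume av: "a \<in> carrier K" "v \<in> carrier V"
    obtain c w where c: "c \<in> carrier K" "w \<in> W" "v = c \<odot>\<^bsub>V\<^esub> b \<oplus>\<^bsub>V\<^esub> w" using dec av by blast
    have "a \<odot>\<^bsub>V\<^esub> v = (a \<otimes>\<^bsub>K\<^esub> c) \<odot>\<^bsub>V\<^esub> b \<oplus>\<^bsub>V\<^esub> a \<odot>\<^bsub>V\<^esub> w"
      using c av b WV by (simp add: smult_r_distr smult_assoc1)
    then show "f (a \<odot>\<^bsub>V\<^esub> v) = a \<otimes>\<^bsub>K\<^esub> f v"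
      using fI[OF c] fI[of "a \<otimes>\<^bsub>K\<^esub> c" "a \<odot>\<^bsub>V\<^esub> w"] c av submodule.smult_closed[OF W] by simp
  qed
qed

text \<open>A basis is infinite here and contains a sequence \<open>b\<close>; \<open>f n\<close> is
  the coefficient functional of \<open>b n\<close>. Supports are finite because a vector involves
  only finitely many basis elements.\<close>

lemma infinite_dim_coordinates:
  assumes "\<not> fin_dim"
  obtains b :: "nat \<Rightarrow> 'c" and f :: "nat \<Rightarrow> 'c \<Rightarrow> 'a" where
    "\<And>n. b n \<in> carrier V"
    "\<And>m n. f m (b n) = (if m = n then \<one>\<^bsub>K\<^esub> else \<zero>\<^bsub>K\<^esub>)"
    "\<And>v. v \<in> carrier V \<Longrightarrow> (\<lambda>n. f n v) \<in> fin_seqs K"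
    "\<And>n u v. u \<in> carrier V \<Longrightarrow> v \<in> carrier V \<Longrightarrow> f n (u \<oplus>\<^bsub>V\<^esub> v) = f n u \<oplus>\<^bsub>K\<^esub> f n v"
    "\<And>n c v. c \<in> carrier K \<Longrightarrow> v \<in> carrier V \<Longrightarrow> f n (c \<odot>\<^bsub>V\<^esub> v) = c \<otimes>\<^bsub>K\<^esub> f n v"
proof -
  obtain B where B: "B \<subseteq> carrier V" "lin_indpt B" "span B = carrier V"
    by (rule ex_maximal_lin_indpt)
  have "infinite B" using assms B unfolding fin_dim_def by blast
  then obtain b :: "nat \<Rightarrow> 'c" where b: "inj b" "range b \<subseteq> B"
    using infinite_countable_subset by blast
  have bB: "b n \<in> B" for n using b by auto
  \<comment> \<open>A complement of the line through \<open>b n\<close>. If \<open>b n\<close> lay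
    in it, the basis would be dependent.\<close>
  define W where "W n = span (B - {b n})" for n
  have BV: "B - {b n} \<subseteq> carrier V" for n using B by blast
  have nin: "b n \<notin> W n" for n
  proof -
    have "lin_indpt (B - {b n})" using B(2) by (metis Diff_subset subset_li_is_li)
    then show ?thesis
      using lin_dep_iff_in_span[OF BV, of n "b n"] B bB[of n]
      by (auto simp: W_def insert_absorb)
  qed
  have dec: "\<exists>c\<in>carrier K. \<exists>w\<in>W n. v = c \<odot>\<^bsub>V\<^esub> b n \<oplus>\<^bsub>V\<^esub> w" if v: "v \<in> carrier V" for n v
  proof -
    have "v \<in> span B" using v B(3) by simp
    then obtain a A where A: "finite A" "A \<subseteq> B" "a \<in> A \<rightarrow> carrier K" "v = lincomb a A"
      unfolding span_def by blast
    have "lincomb a (A - {b n}) \<in> W n"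
      unfolding W_def span_def using A by blast
    moreover have "v = (if b n \<in> A then a (b n) else \<zero>\<^bsub>K\<^esub>) \<odot>\<^bsub>V\<^esub> b n \<oplus>\<^bsub>V\<^esub> lincomb a (A - {b n})"
    proof (cases "b n \<in> A")
      case True
      then show ?thesis using A lincomb_del2[of A a "b n"] B(1) by auto
    next
      case False
      moreover have "b n \<in> carrier V" using B(1) bB by blast
      ultimately show ?thesis using A(4) v by simp
    qed
    moreover have "(if b n \<in> A then a (b n) else \<zero>\<^bsub>K\<^esub>) \<in> carrier K" using A(3) by auto
    ultimately show ?thesis by blast
  qed
  have "\<forall>n. \<exists>f. (\<forall>v\<in>carrier V. f v \<in> carrier K) \<and> f (b n) = \<one>\<^bsub>K\<^esub> \<and> (\<forall>w\<in>W n. f w = \<zero>\<^bsub>K\<^esub>) \<and>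
    (\<forall>u\<in>carrier V. \<forall>v\<in>carrier V. f (u \<oplus>\<^bsub>V\<^esub> v) = f u \<oplus>\<^bsub>K\<^esub> f v) \<and>
    (\<forall>c\<in>carrier K. \<forall>v\<in>carrier V. f (c \<odot>\<^bsub>V\<^esub> v) = c \<otimes>\<^bsub>K\<^esub> f v)"
  proof (intro allI ex_functional[OF _ _ nin dec])
    fix n
    show "submodule K (W n) V" unfolding W_def by (rule span_is_submodule[OF BV])
    show "b n \<in> carrier V" using bB B by blast
  qed
  then obtain f where f:
    "\<And>n v. v \<in> carrier V \<Longrightarrow> f n v \<in> carrier K" "\<And>n. f n (b n) = \<one>\<^bsub>K\<^esub>"
    "\<And>n w. w \<in> W n \<Longrightarrow> f n w = \<zero>\<^bsub>K\<^esub>"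
    "\<And>n u v. u \<in> carrier V \<Longrightarrow> v \<in> carrier V \<Longrightarrow> f n (u \<oplus>\<^bsub>V\<^esub> v) = f n u \<oplus>\<^bsub>K\<^esub> f n v"
    "\<And>n c v. c \<in> carrier K \<Longrightarrow> v \<in> carrier V \<Longrightarrow> f n (c \<odot>\<^bsub>V\<^esub> v) = c \<otimes>\<^bsub>K\<^esub> f n v"
    unfolding choice_iff by blast
  show thesis
  proof (rule that[of b f])
    show "b n \<in> carrier V" for n using bB B by blast
    show "f m (b n) = (if m = n then \<one>\<^bsub>K\<^esub> else \<zero>\<^bsub>K\<^esub>)" for m n
    proof (cases "m = n")
      case False
      then have "b n \<in> B - {b m}" using bB b(1) by (auto dest: injD)
      then have "b n \<in> W m" unfolding W_def using in_own_span[OF BV] by blast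
      with False f(3) show ?thesis by simp
    qed (simp add: f(2))
    show "(\<lambda>n. f n v) \<in> fin_seqs K" if v: "v \<in> carrier V" for v
    proof -
      have "v \<in> span B" using v B(3) by simp
      then obtain a A where A: "finite A" "A \<subseteq> B" "a \<in> A \<rightarrow> carrier K" "v = lincomb a A"
        unfolding span_def by blast
      have "f n v = \<zero>\<^bsub>K\<^esub>" if "b n \<notin> A" for n
        using A that by (intro f(3)) (auto simp: W_def span_def)
      \<comment> \<open>Only basis vectors occurring in \<open>A\<close> contribute, and by
        injectivity of \<open>b\<close> each has at most one index.\<close>
      then have "{n. f n v \<noteq> \<zero>\<^bsub>K\<^esub>} \<subseteq> b -` A" by auto
      then have "finite {n. f n v \<noteq> \<zero>\<^bsub>K\<^esub>}"
        using finite_vimageI[OF A(1) b(1)] finite_subset by blast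
      then show ?thesis using f(1)[OF v] by (simp add: fin_seqs_def)
    qed
  qed (use f in auto)
qed

lemma fin_seqs_add:
  assumes "c \<in> fin_seqs K" "d \<in> fin_seqs K"
  shows "(\<lambda>n. c n \<oplus>\<^bsub>K\<^esub> d n) \<in> fin_seqs K"
proof -
  have "{n. c n \<oplus>\<^bsub>K\<^esub> d n \<noteq> \<zero>\<^bsub>K\<^esub>} \<subseteq> {n. c n \<noteq> \<zero>\<^bsub>K\<^esub>} \<union> {n. d n \<noteq> \<zero>\<^bsub>K\<^esub>}" by auto
  then show ?thesis using assms unfolding fin_seqs_def
    by (auto intro: finite_subset)
qed

lemma fin_seqs_smult:
  assumes "a \<in> carrier K" "c \<in> fin_seqs K"
  shows "(\<lambda>n. a \<otimes>\<^bsub>K\<^esub> c n) \<in> fin_seqs K"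
proof -
  have "{n. a \<otimes>\<^bsub>K\<^esub> c n \<noteq> \<zero>\<^bsub>K\<^esub>} \<subseteq> {n. c n \<noteq> \<zero>\<^bsub>K\<^esub>}" using assms(1) by auto
  then show ?thesis using assms unfolding fin_seqs_def
    by (auto intro: finite_subset)
qed

text \<open>The map \<open>E\<close> embeds the finitely supported sequences linearly, as
  combinations of the \<open>b n\<close>, and the functionals \<open>f n\<close> give a linear left
  inverse. An automaton can thus be defined in coordinates without assuming countable
  dimension.\<close>

lemma infinite_dim_retract:
  assumes "\<not> fin_dim"
  obtains E :: "(nat \<Rightarrow> 'a) \<Rightarrow> 'c" and f :: "nat \<Rightarrow> 'c \<Rightarrow> 'a" where
    "\<And>c. c \<in> fin_seqs K \<Longrightarrow> E c \<in> carrier V"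
    "\<And>n c. c \<in> fin_seqs K \<Longrightarrow> f n (E c) = c n"
    "\<And>c d. c \<in> fin_seqs K \<Longrightarrow> d \<in> fin_seqs K \<Longrightarrow> E (\<lambda>n. c n \<oplus>\<^bsub>K\<^esub> d n) = E c \<oplus>\<^bsub>V\<^esub> E d"
    "\<And>a c. a \<in> carrier K \<Longrightarrow> c \<in> fin_seqs K \<Longrightarrow> E (\<lambda>n. a \<otimes>\<^bsub>K\<^esub> c n) = a \<odot>\<^bsub>V\<^esub> E c"
    "\<And>v. v \<in> carrier V \<Longrightarrow> (\<lambda>n. f n v) \<in> fin_seqs K"
    "\<And>n u v. u \<in> carrier V \<Longrightarrow> v \<in> carrier V \<Longrightarrow> f n (u \<oplus>\<^bsub>V\<^esub> v) = f n u \<oplus>\<^bsub>K\<^esub> f n v"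
    "\<And>n c v. c \<in> carrier K \<Longrightarrow> v \<in> carrier V \<Longrightarrow> f n (c \<odot>\<^bsub>V\<^esub> v) = c \<otimes>\<^bsub>K\<^esub> f n v"
proof -
  obtain b :: "nat \<Rightarrow> 'c" and f :: "nat \<Rightarrow> 'c \<Rightarrow> 'a" where
    b: "\<And>n. b n \<in> carrier V"
    and fb: "\<And>m n. f m (b n) = (if m = n then \<one>\<^bsub>K\<^esub> else \<zero>\<^bsub>K\<^esub>)"
    and f: "\<And>v. v \<in> carrier V \<Longrightarrow> (\<lambda>n. f n v) \<in> fin_seqs K"
    and f_add: "\<And>n u v. u \<in> carrier V \<Longrightarrow> v \<in> carrier V \<Longrightarrow> f n (u \<oplus>\<^bsub>V\<^esub> v) = f n u \<oplus>\<^bsub>K\<^esub> f n v"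
    and f_smult: "\<And>n c v. c \<in> carrier K \<Longrightarrow> v \<in> carrier V \<Longrightarrow> f n (c \<odot>\<^bsub>V\<^esub> v) = c \<otimes>\<^bsub>K\<^esub> f n v"
    by (rule infinite_dim_coordinates[OF assms]) (rule that, assumption+)
  define E where "E c = (\<Oplus>\<^bsub>V\<^esub>n\<in>{n. c n \<noteq> \<zero>\<^bsub>K\<^esub>}. c n \<odot>\<^bsub>V\<^esub> b n)" for c
  \<comment> \<open>The supports of two sequences and of their sum may differ; padding with zero
    coefficients brings all sums to one finite index set.\<close>
  have E_eq: "E c = (\<Oplus>\<^bsub>V\<^esub>n\<in>A. c n \<odot>\<^bsub>V\<^esub> b n)"
    if "c \<in> fin_seqs K" "finite A" "{n. c n \<noteq> \<zero>\<^bsub>K\<^esub>} \<subseteq> A" for c A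
    unfolding E_def using that b
    by (intro M.add.finprod_mono_neutral_cong_left) (auto simp: fin_seqs_def)
  have f_zero: "f n \<zero>\<^bsub>V\<^esub> = \<zero>\<^bsub>K\<^esub>" for n
    using f_smult[of "\<zero>\<^bsub>K\<^esub>" "\<zero>\<^bsub>V\<^esub>" n] f[of "\<zero>\<^bsub>V\<^esub>"] by (auto simp: fin_seqs_def)
  have coeff: "f m (\<Oplus>\<^bsub>V\<^esub>n\<in>A. c n \<odot>\<^bsub>V\<^esub> b n) = (if m \<in> A then c m else \<zero>\<^bsub>K\<^esub>)"
    if "finite A" "\<And>n. c n \<in> carrier K" for m A c
    using that(1)
  proof induction
    case (insert k A)
    have "(\<Oplus>\<^bsub>V\<^esub>n\<in>A. c n \<odot>\<^bsub>V\<^esub> b n) \<in> carrier V"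
      using that(2) b by (intro M.finsum_closed) auto
    then show ?case
      using insert that(2) b by (auto simp: f_add f_smult fb)
  qed (simp add: f_zero)
  show thesis
  proof (rule that[of E f])
    show "E c \<in> carrier V" if "c \<in> fin_seqs K" for c
      unfolding E_def using that b by (intro M.finsum_closed) (auto simp: fin_seqs_def)
    show "f n (E c) = c n" if "c \<in> fin_seqs K" for n c
      unfolding E_def using that coeff[of "{n. c n \<noteq> \<zero>\<^bsub>K\<^esub>}" c n] by (auto simp: fin_seqs_def)
    show "E (\<lambda>n. c n \<oplus>\<^bsub>K\<^esub> d n) = E c \<oplus>\<^bsub>V\<^esub> E d"
      if c: "c \<in> fin_seqs K" and d: "d \<in> fin_seqs K" for c d
    proof -
      define A where "A = {n. c n \<noteq> \<zero>\<^bsub>K\<^esub>} \<union> {n. d n \<noteq> \<zero>\<^bsub>K\<^esub>}"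
      have A: "finite A" using c d by (simp add: A_def fin_seqs_def)
      have K: "c n \<in> carrier K" "d n \<in> carrier K" for n using c d by (auto simp: fin_seqs_def)
      have "E (\<lambda>n. c n \<oplus>\<^bsub>K\<^esub> d n) = (\<Oplus>\<^bsub>V\<^esub>n\<in>A. (c n \<oplus>\<^bsub>K\<^esub> d n) \<odot>\<^bsub>V\<^esub> b n)"
        by (rule E_eq[OF fin_seqs_add[OF c d] A]) (auto simp: A_def)
      also have "\<dots> = (\<Oplus>\<^bsub>V\<^esub>n\<in>A. c n \<odot>\<^bsub>V\<^esub> b n \<oplus>\<^bsub>V\<^esub> d n \<odot>\<^bsub>V\<^esub> b n)"
        using K b by (simp add: smult_l_distr)
      also have "\<dots> = (\<Oplus>\<^bsub>V\<^esub>n\<in>A. c n \<odot>\<^bsub>V\<^esub> b n) \<oplus>\<^bsub>V\<^esub> (\<Oplus>\<^bsub>V\<^esub>n\<in>A. d n \<odot>\<^bsub>V\<^esub> b n)"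
        using K b by (intro M.finsum_addf) auto
      also have "\<dots> = E c \<oplus>\<^bsub>V\<^esub> E d"
        using E_eq[OF c A] E_eq[OF d A] by (simp add: A_def)
      finally show ?thesis .
    qed
    show "E (\<lambda>n. a \<otimes>\<^bsub>K\<^esub> c n) = a \<odot>\<^bsub>V\<^esub> E c"
      if a: "a \<in> carrier K" and c: "c \<in> fin_seqs K" for a c
    proof -
      define A where "A = {n. c n \<noteq> \<zero>\<^bsub>K\<^esub>}"
      have A: "finite A" using c by (simp add: A_def fin_seqs_def)
      have K: "c n \<in> carrier K" for n using c by (auto simp: fin_seqs_def)
      have "E (\<lambda>n. a \<otimes>\<^bsub>K\<^esub> c n) = (\<Oplus>\<^bsub>V\<^esub>n\<in>A. (a \<otimes>\<^bsub>K\<^esub> c n) \<odot>\<^bsub>V\<^esub> b n)"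
        using a by (intro E_eq[OF fin_seqs_smult[OF a c] A]) (auto simp: A_def)
      also have "\<dots> = (\<Oplus>\<^bsub>V\<^esub>n\<in>A. a \<odot>\<^bsub>V\<^esub> (c n \<odot>\<^bsub>V\<^esub> b n))"
        using K b a by (simp add: smult_assoc1)
      also have "\<dots> = a \<odot>\<^bsub>V\<^esub> E c"
        unfolding E_def A_def using K b a by (subst finsum_smult) auto
      finally show ?thesis .
    qed
  qed (use f f_add f_smult in auto)
qed

end

section \<open>Universal sequences and walks that leave a finite set\<close>

text \<open>There are only countably many words over \<open>S\<close>; the sequence is the
  concatenation of an enumeration of them.\<close>

lemma universal_sequence:
  assumes "countable S" "S \<noteq> {}"
  obtains s :: "nat \<Rightarrow> 'b" where "range s \<subseteq> S" "\<And>u. u \<in> lists S \<Longrightarrow> \<exists>n w. map s [0..<n] = w @ u"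
proof -
  obtain a where a: "a \<in> S" using assms by blast
  have ne: "lists S \<noteq> {}" and cnt: "countable (lists S)" using assms(1) by auto
  \<comment> \<open>The letter \<open>a\<close> in front keeps every block nonempty, even for the
    empty word, so the lengths of the prefixes \<open>P k\<close> are unbounded.\<close>
  define L where "L k = a # from_nat_into (lists S) k" for k
  define P where "P k = concat (map L [0..<k])" for k
  \<comment> \<open>The index is in range because \<open>P (Suc n)\<close> has more than
    \<open>n\<close> letters, and longer prefixes agree there because they extend shorter
    ones.\<close>
  define s where "s n = P (Suc n) ! n" for n
  have P_Suc: "P (Suc k) = P k @ L k" for k by (simp add: P_def)
  have len: "k \<le> length (P k)" for k
    by (induction k) (auto simp: P_Suc L_def)
  have prefix: "\<exists>w. P (j + d) = P j @ w" for j d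
    by (induction d) (auto simp: P_Suc)
  have nth: "P k ! i = P j ! i" if "i < length (P j)" "j \<le> k" for i j k
    using prefix[of j "k - j"] that by (auto simp: nth_append)
  have s_nth: "s i = P k ! i" if "i < length (P k)" for i k
    using that nth[of i k "Suc i"] nth[of i "Suc i" k] len[of "Suc i"]
    by (cases "k \<le> Suc i") (auto simp: s_def)
  have map_s: "map s [0..<length (P k)] = P k" for k
    by (rule nth_equalityI) (auto simp: s_nth)
  have PS: "P k \<in> lists S" for k
  proof (induction k)
    case (Suc k)
    then show ?case using from_nat_into[OF ne, of k] a by (auto simp: P_Suc L_def)
  qed (simp add: P_def)
  show thesis
  proof (rule that)
    have "s n \<in> S" for n
      using len[of "Suc n"] PS[of "Suc n"] unfolding s_def in_lists_conv_set
      by (simp add: Suc_le_eq)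
    then show "range s \<subseteq> S" by blast
    fix u assume "u \<in> lists S"
    then obtain k where "u = from_nat_into (lists S) k"
      using from_nat_into_surj[OF cnt] by metis
    then have "P (Suc k) = (P k @ [a]) @ u" by (simp add: P_Suc L_def)
    then show "\<exists>n w. map s [0..<n] = w @ u" using map_s by metis
  qed
qed

text \<open>Start and end count as points of the walk. Leaving \<open>F\<close> and coming back is
  excluded, so a word that fails still fails after being extended on the right.\<close>

primrec stays :: "('g, 'm) monoid_scheme \<Rightarrow> 'g set \<Rightarrow> 'g \<Rightarrow> 'g list \<Rightarrow> bool" where
  "stays G F g [] \<longleftrightarrow> g \<in> F"
| "stays G F g (a # u) \<longleftrightarrow> g \<in> F \<and> stays G F (g \<otimes>\<^bsub>G\<^esub> a) u"

lemma stays_start: "stays G F g u \<Longrightarrow> g \<in> F"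
  by (cases u) auto

lemma stays_append:
  "stays G F g (u @ v) \<longleftrightarrow> stays G F g u \<and> stays G F (foldl (\<otimes>\<^bsub>G\<^esub>) g u) v"
  by (induction u arbitrary: g) (auto dest: stays_start)

lemma stays_end: "stays G F g u \<Longrightarrow> foldl (\<otimes>\<^bsub>G\<^esub>) g u \<in> F"
  by (induction u arbitrary: g) auto

context group
begin

text \<open>Start points are treated one at a time: a word that works for \<open>D\<close> is
  extended by one that takes the current position of the next point out of \<open>F\<close>.
  Finitely many starts suffice, since starts outside \<open>F\<close> fail at once.\<close>

lemma ex_exiting_word:
  assumes S: "S \<subseteq> carrier G" and F: "finite F" "F \<subseteq> carrier G"
    and exit: "\<And>g. g \<in> carrier G \<Longrightarrow> \<exists>u\<in>lists S. foldl (\<otimes>) g u \<notin> F"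
  obtains u where "u \<in> lists S" "\<And>g. \<not> stays G F g u"
proof -
  have "\<exists>u\<in>lists S. \<forall>g\<in>D. \<not> stays G F g u" if "finite D" "D \<subseteq> carrier G" for D
    using that
  proof (induction D rule: finite_induct)
    case (insert h D)
    then obtain u where u: "u \<in> lists S" "\<forall>g\<in>D. \<not> stays G F g u" by auto
    have "foldl (\<otimes>) h u \<in> carrier G"
      using insert.prems u(1) lists_mono[OF S] by (intro foldl_mult_closed) auto
    then obtain v where "v \<in> lists S" "foldl (\<otimes>) (foldl (\<otimes>) h u) v \<notin> F" using exit by blast
    with u show ?case
      by (intro bexI[of _ "u @ v"]) (auto simp: stays_append dest: stays_end)
  qed (auto intro: bexI[of _ "[]"])
  from this[OF F] that show thesis by (meson stays_start)
qed

text \<open>If an initial segment of \<open>s\<close> ends in the reversal of an exiting word, then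
  its own reversal begins with that word. A longer segment, once reversed, first moves the start by
  new letters, but the exiting word works from every start.\<close>

lemma eventually_not_stays:
  assumes s: "range s \<subseteq> S" and S: "S \<subseteq> carrier G" and F: "finite F" "F \<subseteq> carrier G"
    and univ: "\<And>u. u \<in> lists S \<Longrightarrow> \<exists>n w. map s [0..<n] = w @ u"
    and exit: "\<And>g. g \<in> carrier G \<Longrightarrow> \<exists>u\<in>lists S. foldl (\<otimes>) g u \<notin> F"
  shows "finite {n. stays G F g (rev (map s [0..<n]))}"
proof -
  obtain u where u: "u \<in> lists S" "\<And>g. \<not> stays G F g u"
    using ex_exiting_word[OF S F exit] by blast
  have "rev u \<in> lists S" using u(1) by auto
  then obtain N w where N: "map s [0..<N] = w @ rev u" using univ by blast
  have "\<not> stays G F g (rev (map s [0..<N + d]))" for d g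
  proof (induction d arbitrary: g)
    case 0
    then show ?case using N u(2) by (simp add: stays_append)
  qed simp
  then have "{n. stays G F g (rev (map s [0..<n]))} \<subseteq> {..<N}"
    by (metis (mono_tags, lifting) le_Suc_ex lessThan_iff linorder_not_less mem_Collect_eq subsetI)
  then show ?thesis using finite_subset by blast
qed

section \<open>A linear cellular automaton whose image is not closed\<close>

lemma exists_linear_automaton_not_closed:
  fixes K :: "'k ring" and V :: "('k, 'v) module"
  assumes nlf: "\<not> locally_finite_group G"
    and vs: "vectorspace K V" and inf: "\<not> vectorspace.fin_dim K V"
  shows "\<exists>\<tau>. linear_cellular_automaton G K V \<tau> \<and> \<not> has_closed_image G (carrier V) \<tau>"
proof -
  interpret V: vectorspace K V by (rule vs)
  obtain S where S: "finite S" "S \<subseteq> carrier G" "S \<noteq> {}"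
    and exit: "\<And>F g. finite F \<Longrightarrow> g \<in> carrier G \<Longrightarrow> \<exists>u\<in>lists S. foldl (\<otimes>) g u \<notin> F"
    by (rule not_locally_finiteE[OF nlf]) (rule that, assumption+)
  obtain s :: "nat \<Rightarrow> 'a" where s: "range s \<subseteq> S"
    and univ: "\<And>u. u \<in> lists S \<Longrightarrow> \<exists>n w. map s [0..<n] = w @ u"
    by (rule universal_sequence[OF countable_finite[OF S(1)] S(3)]) (rule that, assumption+)
  have sS: "s n \<in> S" "s n \<in> carrier G" for n using s S(2) by auto
  obtain E :: "(nat \<Rightarrow> 'k) \<Rightarrow> 'v" and f :: "nat \<Rightarrow> 'v \<Rightarrow> 'k" where
    E: "\<And>c. c \<in> fin_seqs K \<Longrightarrow> E c \<in> carrier V"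
    and fE: "\<And>n c. c \<in> fin_seqs K \<Longrightarrow> f n (E c) = c n"
    and E_add: "\<And>c d. c \<in> fin_seqs K \<Longrightarrow> d \<in> fin_seqs K \<Longrightarrow>
      E (\<lambda>n. c n \<oplus>\<^bsub>K\<^esub> d n) = E c \<oplus>\<^bsub>V\<^esub> E d"
    and E_smult: "\<And>a c. a \<in> carrier K \<Longrightarrow> c \<in> fin_seqs K \<Longrightarrow>
      E (\<lambda>n. a \<otimes>\<^bsub>K\<^esub> c n) = a \<odot>\<^bsub>V\<^esub> E c"
    and f: "\<And>v. v \<in> carrier V \<Longrightarrow> (\<lambda>n. f n v) \<in> fin_seqs K"
    and f_add: "\<And>n u v. u \<in> carrier V \<Longrightarrow> v \<in> carrier V \<Longrightarrow> f n (u \<oplus>\<^bsub>V\<^esub> v) = f n u \<oplus>\<^bsub>K\<^esub> f n v"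
    and f_smult: "\<And>n c v. c \<in> carrier K \<Longrightarrow> v \<in> carrier V \<Longrightarrow> f n (c \<odot>\<^bsub>V\<^esub> v) = c \<otimes>\<^bsub>K\<^esub> f n v"
    by (rule V.infinite_dim_retract[OF inf]) (rule that, assumption+)
  have fK: "f n v \<in> carrier K" if "v \<in> carrier V" for n v
    using f[OF that] by (simp add: fin_seqs_def)
  define M where "M = insert \<one> S"
  have M: "finite M" "M \<subseteq> carrier G" "\<one> \<in> M" "s n \<in> M" for n using S sS by (auto simp: M_def)
  \<comment> \<open>Coordinate \<open>m\<close> of the neighbour in direction \<open>s m\<close>
    becomes coordinate \<open>Suc m\<close>. All directions lie in the finite set \<open>S\<close>,
    so a finite memory serves infinitely many coordinates.\<close>
  define sh where "sh z n = (case n of 0 \<Rightarrow> \<zero>\<^bsub>K\<^esub> | Suc m \<Rightarrow> f m (z (s m)))" for z :: "'a \<Rightarrow> 'v" and n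
  have sh_Suc: "sh z (Suc m) = f m (z (s m))" and sh_0: "sh z 0 = \<zero>\<^bsub>K\<^esub>" for z m
    by (auto simp: sh_def)
  have sh: "sh z \<in> fin_seqs K" if z: "z \<in> M \<rightarrow>\<^sub>E carrier V" for z
  proof -
    have zV: "z t \<in> carrier V" if "t \<in> M" for t using z that by blast
    have "sh z n \<in> carrier K" for n
      using zV M(4) fK by (cases n) (auto simp: sh_0 sh_Suc)
    \<comment> \<open>Each of the finitely many neighbours contributes a finite support, moved up by
      one.\<close>
    moreover have "{n. sh z n \<noteq> \<zero>\<^bsub>K\<^esub>} \<subseteq> Suc ` (\<Union>t\<in>S. {m. f m (z t) \<noteq> \<zero>\<^bsub>K\<^esub>})"
    proof
      fix n assume "n \<in> {n. sh z n \<noteq> \<zero>\<^bsub>K\<^esub>}"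
      then show "n \<in> Suc ` (\<Union>t\<in>S. {m. f m (z t) \<noteq> \<zero>\<^bsub>K\<^esub>})"
        using sS by (cases n) (auto simp: sh_0 sh_Suc)
    qed
    moreover have "finite (Suc ` (\<Union>t\<in>S. {m. f m (z t) \<noteq> \<zero>\<^bsub>K\<^esub>}))"
      using S(1) f zV by (auto simp: M_def fin_seqs_def)
    ultimately show ?thesis unfolding fin_seqs_def using finite_subset by blast
  qed
  \<comment> \<open>In coordinates, \<open>\<tau>(x) = y\<close> says \<open>x\<^sub>0 = 1\<close> and \<open>x\<^sub>n\<^sub>+\<^sub>1(g) = x\<^sub>n(g s\<^sub>n)\<close>.\<close>
  define \<mu> where "\<mu> z = z \<one> \<ominus>\<^bsub>V\<^esub> E (sh z)" for z
  have \<mu>: "\<mu> \<in> (M \<rightarrow>\<^sub>E carrier V) \<rightarrow> carrier V"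
    using M(3) E[OF sh] unfolding \<mu>_def by (blast intro: V.M.minus_closed)
  have "\<mu> \<in> module_hom K (power_space V M) V"
  proof -
    have "\<mu> (\<lambda>m\<in>M. z m \<oplus>\<^bsub>V\<^esub> w m) = \<mu> z \<oplus>\<^bsub>V\<^esub> \<mu> w"
      if z: "z \<in> M \<rightarrow>\<^sub>E carrier V" and w: "w \<in> M \<rightarrow>\<^sub>E carrier V" for z w
    proof -
      have V: "z m \<in> carrier V" "w m \<in> carrier V" if "m \<in> M" for m using z w that by blast+
      have "sh (\<lambda>m\<in>M. z m \<oplus>\<^bsub>V\<^esub> w m) = (\<lambda>n. sh z n \<oplus>\<^bsub>K\<^esub> sh w n)"
      proof
        show "sh (\<lambda>m\<in>M. z m \<oplus>\<^bsub>V\<^esub> w m) n = sh z n \<oplus>\<^bsub>K\<^esub> sh w n" for n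
          using V M(4) f_add by (cases n) (auto simp: sh_0 sh_Suc)
      qed
      then show ?thesis
        using V[OF M(3)] E[OF sh[OF z]] E[OF sh[OF w]] E_add[OF sh[OF z] sh[OF w]] M(3)
        by (simp add: \<mu>_def V.M.minus_eq V.M.minus_add V.M.a_ac)
    qed
    moreover have "\<mu> (\<lambda>m\<in>M. a \<odot>\<^bsub>V\<^esub> z m) = a \<odot>\<^bsub>V\<^esub> \<mu> z"
      if a: "a \<in> carrier K" and z: "z \<in> M \<rightarrow>\<^sub>E carrier V" for a z
    proof -
      have V: "z m \<in> carrier V" if "m \<in> M" for m using z that by blast
      have "sh (\<lambda>m\<in>M. a \<odot>\<^bsub>V\<^esub> z m) = (\<lambda>n. a \<otimes>\<^bsub>K\<^esub> sh z n)"
      proof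
        show "sh (\<lambda>m\<in>M. a \<odot>\<^bsub>V\<^esub> z m) n = a \<otimes>\<^bsub>K\<^esub> sh z n" for n
          using a V M(4) f_smult by (cases n) (auto simp: sh_0 sh_Suc)
      qed
      then show ?thesis
        using a V[OF M(3)] E[OF sh[OF z]] E_smult[OF a sh[OF z]] M(3)
        by (simp add: \<mu>_def V.M.minus_eq V.smult_r_distr V.smult_r_minus)
    qed
    ultimately show ?thesis
      using \<mu> by (auto simp: module_hom_def power_space_def)
  qed
  then have lca: "linear_cellular_automaton G K V (local_map G M \<mu>)"
    using memory_rule_local_map[OF M(1,2) \<mu>] local_map_closed[OF M(2) \<mu>]
    unfolding linear_cellular_automaton_def by blast
  \<comment> \<open>Coordinates of the constant target: the initial value one at index zero and no
    further inhomogeneity.\<close>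
  define \<delta> where "\<delta> n = (if n = 0 then \<one>\<^bsub>K\<^esub> else \<zero>\<^bsub>K\<^esub>)" for n :: nat
  have \<delta>: "\<delta> \<in> fin_seqs K" by (auto simp: fin_seqs_def \<delta>_def)
  define y where "y = (\<lambda>g\<in>carrier G. E \<delta>)"
  have z: "(\<lambda>m\<in>M. x (g \<otimes> m)) \<in> M \<rightarrow>\<^sub>E carrier V"
    if "x \<in> configurations G (carrier V)" "g \<in> carrier G" for x g
    using that M(2) by (rule configurations_translate)
  have "\<not> has_closed_image G (carrier V) (local_map G M \<mu>)"
  proof (rule not_has_closed_imageI)
    show "y \<in> configurations G (carrier V)" using E[OF \<delta>] by (auto simp: y_def configurations_def)
  next
    fix F assume F: "finite F" "F \<subseteq> carrier G"
    \<comment> \<open>The word is reversed because coordinate \<open>Suc m\<close> at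
      \<open>g\<close> refers to \<open>g \<otimes> s m\<close>, so the last letter of the segment
      is used first.\<close>
    define \<chi> where "\<chi> g n = (if stays G F g (rev (map s [0..<n])) then \<one>\<^bsub>K\<^esub> else \<zero>\<^bsub>K\<^esub>)" for g n
    have \<chi>: "\<chi> g \<in> fin_seqs K" for g
      using eventually_not_stays[OF s S(2) F univ exit[OF F(1)], of g]
      by (auto simp: fin_seqs_def \<chi>_def)
    define x where "x = (\<lambda>g\<in>carrier G. E (\<chi> g))"
    have x: "x \<in> configurations G (carrier V)" using E[OF \<chi>] by (auto simp: x_def configurations_def)
    have "local_map G M \<mu> x g = y g" if g: "g \<in> F" for g
    proof -
      have gc: "g \<in> carrier G" using g F by blast
      define z where "z = (\<lambda>m\<in>M. x (g \<otimes> m))"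
      have zV: "z \<in> M \<rightarrow>\<^sub>E carrier V" unfolding z_def by (rule z[OF x gc])
      \<comment> \<open>At index zero the walk is the single point \<open>g\<close> of
        \<open>F\<close>, giving one; at \<open>Suc m\<close> its first step leads to
        \<open>g \<otimes> s m\<close>, where the walk for \<open>m\<close> begins.\<close>
      have "\<chi> g = (\<lambda>n. \<delta> n \<oplus>\<^bsub>K\<^esub> sh z n)"
      proof
        fix n
        show "\<chi> g n = \<delta> n \<oplus>\<^bsub>K\<^esub> sh z n"
        proof (cases n)
          case (Suc m)
          have "z (s m) = E (\<chi> (g \<otimes> s m))" using M(4) gc sS by (simp add: z_def x_def)
          then have "sh z n = \<chi> (g \<otimes> s m) m" using Suc fE[OF \<chi>] by (simp add: sh_Suc)
          then show ?thesis using Suc g by (auto simp: \<delta>_def \<chi>_def)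
        qed (use g in \<open>simp add: \<chi>_def \<delta>_def sh_0\<close>)
      qed
      then have "E (\<chi> g) = E \<delta> \<oplus>\<^bsub>V\<^esub> E (sh z)" using E_add[OF \<delta> sh[OF zV]] by simp
      moreover have "local_map G M \<mu> x g = E (\<chi> g) \<ominus>\<^bsub>V\<^esub> E (sh z)"
        using gc M(3) by (simp add: local_map_def \<mu>_def z_def x_def)
      ultimately show ?thesis
        using gc E[OF \<delta>] E[OF sh[OF zV]] by (simp add: y_def V.M.minus_eq V.M.a_assoc V.M.r_neg)
    qed
    with x show "\<exists>x\<in>configurations G (carrier V). \<forall>g\<in>F. local_map G M \<mu> x g = y g" by blast
  next
    fix x assume x: "x \<in> configurations G (carrier V)"
    have xV: "x g \<in> carrier V" if "g \<in> carrier G" for g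
      using x that by (auto simp: configurations_def)
    show "local_map G M \<mu> x \<noteq> y"
    proof
      assume eq: "local_map G M \<mu> x = y"
      \<comment> \<open>Solve the equation for \<open>x g\<close> and apply \<open>f n\<close>,
        which undoes \<open>E\<close>.\<close>
      have rec: "f n (x g) = \<delta> n \<oplus>\<^bsub>K\<^esub> sh (\<lambda>m\<in>M. x (g \<otimes> m)) n" if g: "g \<in> carrier G" for n g
      proof -
        note zV = z[OF x g]
        have "x g \<ominus>\<^bsub>V\<^esub> E (sh (\<lambda>m\<in>M. x (g \<otimes> m))) = E \<delta>"
          using fun_cong[OF eq, of g] g M(3) by (simp add: local_map_def \<mu>_def y_def)
        then have "x g = E \<delta> \<oplus>\<^bsub>V\<^esub> E (sh (\<lambda>m\<in>M. x (g \<otimes> m)))"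
          using xV[OF g] E[OF \<delta>] E[OF sh[OF zV]]
          by (metis V.M.add.inv_solve_right' V.M.minus_eq V.M.minus_closed)
        then show ?thesis using f_add E[OF \<delta>] E[OF sh[OF zV]] fE[OF \<delta>] fE[OF sh[OF zV]] by simp
      qed
      \<comment> \<open>The base point moves from \<open>g\<close> to \<open>g \<otimes> s n\<close>
        in the induction, so the claim is proved for all group elements at once.\<close>
      have "f n (x g) = \<one>\<^bsub>K\<^esub>" if "g \<in> carrier G" for n g
        using that
      proof (induction n arbitrary: g)
        case 0
        then show ?case using rec[of g 0] by (simp add: \<delta>_def sh_0)
      next
        case (Suc n)
        then show ?case using rec[of g "Suc n"] sS M(4) by (simp add: \<delta>_def sh_Suc)
      qed
      then have "{n. f n (x \<one>) \<noteq> \<zero>\<^bsub>K\<^esub>} = UNIV" by simp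
      then show False using f[OF xV[OF one_closed]] by (simp add: fin_seqs_def)
    qed
  qed
  with lca show ?thesis by blast
qed

end

section \<open>Infinite-dimensional spaces over prescribed types\<close>

text \<open>This keeps the quantifiers over spaces from being vacuous: it supplies the instance for
  the universal linear condition and the witness for the existential one.\<close>

lemma ex_infinite_dim_vectorspace:
  assumes "\<exists>s t :: 'k. s \<noteq> t" and "infinite (UNIV :: 'v set)"
  shows "\<exists>(K :: 'k ring) (V :: ('k, 'v) module). field K \<and> vectorspace K V \<and> \<not> vectorspace.fin_dim K V"
proof -
  obtain s t :: 'k where st: "s \<noteq> t" using assms(1) by blast
  obtain e :: "nat \<Rightarrow> 'v" where e: "inj e" using assms(2) infinite_countable_subset by blast
  define d where "d = inv_into UNIV e"
  have d: "d (e n) = n" for n using e by (simp add: d_def)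
  \<comment> \<open>The field with two elements on \<open>{s, t}\<close>, acting on the natural numbers under bitwise xor.\<close>
  define K :: "'k ring" where "K = \<lparr>carrier = {s, t},
    mult = (\<lambda>x y. if x = t \<and> y = t then t else s), one = t, zero = s,
    add = (\<lambda>x y. if x = y then s else t)\<rparr>"
  define V :: "('k, 'v) module" where "V = \<lparr>carrier = range e, mult = (\<lambda>x y. x), one = e 0,
    zero = e 0, add = (\<lambda>x y. e (semiring_bit_operations_class.xor (d x) (d y))),
    smult = (\<lambda>c x. if c = t then x else e 0)\<rparr>"
  have "cring K"
  proof (rule cringI)
    show "abelian_group K" using st by (intro abelian_groupI) (auto simp: K_def)
    show "Group.comm_monoid K" using st by (intro comm_monoidI) (auto simp: K_def)
  qed (auto simp: K_def)
  then have K: "field K"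
    using st by (intro cring.cring_fieldI) (auto simp: K_def Units_def)
  \<comment> \<open>Negatives exist because every number is its own inverse under xor.\<close>
  have "\<exists>n. e (semiring_bit_operations_class.xor m n) = e 0" for m
    by (intro exI[of _ m]) simp
  then have vs: "vectorspace K V"
    using st by (intro vs_criteria[OF K])
      (auto simp: K_def V_def d semiring_bit_operations_class.xor.assoc
        semiring_bit_operations_class.xor.commute
        semiring_bit_operations_class.xor.left_commute intro!: arg_cong[of _ _ e])
  interpret V: vectorspace K V by (rule vs)
  have "\<not> V.fin_dim"
  proof
    assume V.fin_dim
    then obtain A where A: "finite A" "A \<subseteq> carrier V" "V.span A = carrier V"
      unfolding V.fin_dim_def by blast
    \<comment> \<open>Over a finite field a finite set has only finitely many linear combinations.
      Coefficient functions are restricted to \<open>A\<close> so that they form a finite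
      set.\<close>
    have "carrier V \<subseteq> (\<lambda>a. V.lincomb a A) ` (A \<rightarrow>\<^sub>E carrier K)"
    proof
      fix v assume "v \<in> carrier V"
      then obtain a where a: "a \<in> A \<rightarrow> carrier K" "V.lincomb a A = v"
        using V.finite_in_span[OF A(1,2)] A(3) by blast
      then have "V.lincomb (restrict a A) A = v"
        using V.lincomb_cong[OF refl A(2), of "restrict a A" a] by simp
      with a(1) show "v \<in> (\<lambda>a. V.lincomb a A) ` (A \<rightarrow>\<^sub>E carrier K)" by force
    qed
    moreover have "finite (A \<rightarrow>\<^sub>E carrier K)" using A(1) by (intro finite_PiE) (auto simp: K_def)
    ultimately have "finite (range e)" unfolding V_def using finite_surj by (metis partial_object.select_convs(1))
    with e show False using finite_imageD by blast
  qed
  with K vs show ?thesis by blast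
qed

theorem theorem1p5:
  fixes G :: "('g, 'm) monoid_scheme"
  assumes "group G"
    and "infinite (UNIV :: 'a set)"
    and "infinite (UNIV :: 'b set)"
    and "infinite (UNIV :: 'c set)"
    and "\<exists>s t :: 'k. s \<noteq> t" and "infinite (UNIV :: 'v set)"
    and "\<exists>s t :: 'l. s \<noteq> t" and "infinite (UNIV :: 'w set)"
  shows
    "(locally_finite_group G \<longleftrightarrow>
        (\<forall>A :: 'a set. \<forall>\<tau>. cellular_automaton G A \<tau> \<longrightarrow> has_closed_image G A \<tau>)) \<and>
     (locally_finite_group G \<longleftrightarrow>
        (\<forall>A :: 'b set. infinite A \<longrightarrow>
           (\<forall>\<tau>. cellular_automaton G A \<tau> \<longrightarrow> has_closed_image G A \<tau>))) \<and>
     (locally_finite_group G \<longleftrightarrow>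
        (\<exists>A :: 'c set. infinite A \<and>
           (\<forall>\<tau>. cellular_automaton G A \<tau> \<longrightarrow> has_closed_image G A \<tau>))) \<and>
     (locally_finite_group G \<longleftrightarrow>
        (\<forall>(K :: 'k ring) (V :: ('k, 'v) module). field K \<and> vectorspace K V \<longrightarrow>
           (\<forall>\<tau>. linear_cellular_automaton G K V \<tau> \<longrightarrow> has_closed_image G (carrier V) \<tau>))) \<and>
     (locally_finite_group G \<longleftrightarrow>
        (\<exists>(K :: 'l ring) (V :: ('l, 'w) module).
           field K \<and> vectorspace K V \<and> \<not> vectorspace.fin_dim K V \<and>
           (\<forall>\<tau>. linear_cellular_automaton G K V \<tau> \<longrightarrow> has_closed_image G (carrier V) \<tau>)))"
proof -
  interpret group G by (rule assms(1))
  note closed = has_closed_image_if_locally_finite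
  note not_closed = exists_automaton_not_closed
  \<comment> \<open>Fresh type variables allow this to be used in both universes of vector
    spaces.\<close>
  have linear_closed: "has_closed_image G (carrier V) \<tau>"
    if "locally_finite_group G" "linear_cellular_automaton G K V \<tau>"
    for K :: "'k2 ring" and V :: "('k2, 'v2) module" and \<tau>
    using closed that unfolding linear_cellular_automaton_def cellular_automaton_def by blast
  show ?thesis
  proof (intro conjI iffI)
    assume "locally_finite_group G"
    then show "\<forall>A :: 'a set. \<forall>\<tau>. cellular_automaton G A \<tau> \<longrightarrow> has_closed_image G A \<tau>"
      using closed by blast
  next
    assume "\<forall>A :: 'a set. \<forall>\<tau>. cellular_automaton G A \<tau> \<longrightarrow> has_closed_image G A \<tau>"
    \<comment> \<open>The whole type serves as the infinite alphabet.\<close>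
    then show "locally_finite_group G" using not_closed[OF _ assms(2)] by blast
  next
    assume "locally_finite_group G"
    then show "\<forall>A :: 'b set. infinite A \<longrightarrow>
        (\<forall>\<tau>. cellular_automaton G A \<tau> \<longrightarrow> has_closed_image G A \<tau>)"
      using closed by blast
  next
    assume "\<forall>A :: 'b set. infinite A \<longrightarrow>
        (\<forall>\<tau>. cellular_automaton G A \<tau> \<longrightarrow> has_closed_image G A \<tau>)"
    then show "locally_finite_group G" using not_closed[OF _ assms(3)] assms(3) by blast
  next
    assume "locally_finite_group G"
    then show "\<exists>A :: 'c set. infinite A \<and>
        (\<forall>\<tau>. cellular_automaton G A \<tau> \<longrightarrow> has_closed_image G A \<tau>)"
      using closed assms(4) by blast
  next
    assume "\<exists>A :: 'c set. infinite A \<and>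
        (\<forall>\<tau>. cellular_automaton G A \<tau> \<longrightarrow> has_closed_image G A \<tau>)"
    then show "locally_finite_group G" using not_closed by blast
  next
    assume "locally_finite_group G"
    then show "\<forall>(K :: 'k ring) (V :: ('k, 'v) module). field K \<and> vectorspace K V \<longrightarrow>
        (\<forall>\<tau>. linear_cellular_automaton G K V \<tau> \<longrightarrow> has_closed_image G (carrier V) \<tau>)"
      using linear_closed by blast
  next
    assume *: "\<forall>(K :: 'k ring) (V :: ('k, 'v) module). field K \<and> vectorspace K V \<longrightarrow>
        (\<forall>\<tau>. linear_cellular_automaton G K V \<tau> \<longrightarrow> has_closed_image G (carrier V) \<tau>)"
    obtain K :: "'k ring" and V :: "('k, 'v) module"
      where "field K" "vectorspace K V" "\<not> vectorspace.fin_dim K V"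
      using ex_infinite_dim_vectorspace[OF assms(5,6)] by blast
    with * show "locally_finite_group G" using exists_linear_automaton_not_closed by blast
  next
    assume lf: "locally_finite_group G"
    obtain K :: "'l ring" and V :: "('l, 'w) module"
      where "field K" "vectorspace K V" "\<not> vectorspace.fin_dim K V"
      using ex_infinite_dim_vectorspace[OF assms(7,8)] by blast
    with lf show "\<exists>(K :: 'l ring) (V :: ('l, 'w) module).
        field K \<and> vectorspace K V \<and> \<not> vectorspace.fin_dim K V \<and>
        (\<forall>\<tau>. linear_cellular_automaton G K V \<tau> \<longrightarrow> has_closed_image G (carrier V) \<tau>)"
      using linear_closed by blast
  next
    assume "\<exists>(K :: 'l ring) (V :: ('l, 'w) module).
        field K \<and> vectorspace K V \<and> \<not> vectorspace.fin_dim K V \<and>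
        (\<forall>\<tau>. linear_cellular_automaton G K V \<tau> \<longrightarrow> has_closed_image G (carrier V) \<tau>)"
    then show "locally_finite_group G" using exists_linear_automaton_not_closed by blast
  qed
qed

end
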